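(* Let $d$ be a positive integer such that $d+1$ is prime, let $G$ be a $d$-degenerate graph, and let $v_1,\dots,v_n$ be an ordering of $V(G)$ such that each $v_i$ has $d^-(v_i)\le d$ backward neighbours (neighbours $v_j$ with $j<i$). Let $G'$ be obtained from $G$ by adding, for each $i=1,\dots,n$, exactly $d-d^-(v_i)$ new vertices of degree $1$ adjacent to $v_i$. Let $\eta$ be the index function of $G'$ with $\eta(v_i)=d-d^-(v_i)$ for $i=1,\dots,n$, $\eta(e)=1$ for each edge $e\in E(G)$, and $\eta(z)=0$ for each added vertex and each added edge $z$. Then $\operatorname{per}(A_{G'}(\eta))\not\equiv 0\pmod{d+1}$.
   Context: Graphs are finite and simple. A graph is $d$-degenerate if every subgraph has a vertex of degree at most $d$. For a graph $H$ with a fixed orientation, $A_H$ is the matrix with rows indexed by $E(H)$ and columns indexed by $V(H)\cup E(H)$: for an edge $e$ oriented from $u$ to $v$ and $z\in V(H)\cup E(H)$, $A_H[e,z]=1$ if $z=v$ or $z\ne e$ is an edge incident to $v$; $A_H[e,z]=-1$ if $z=u$ or $z\ne e$ is an edge incident to $u$; and $0$ otherwise. An index function of $H$ is a map $\eta:V(H)\cup E(H)\to\{0,1,2,\dots\}$. $A_H(\eta)$ is the matrix with rows indexed by $E(H)$ whose columns consist of $\eta(z)$ copies of the column of $A_H$ indexed by $z$, for each $z$ (here $A_{G'}(\eta)$ is square). $\operatorname{per}$ denotes the permanent (whose value mod $d+1$ being nonzero does not depend on the orientation or column order). *)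

theory Defs
  imports "HOL-Library.FuncSet" "HOL-Number_Theory.Cong"
begin

record 'a ugraph =
  verts :: "'a set"
  edges :: "'a set set"

definition simple_graph :: "'a ugraph \<Rightarrow> bool" where
  "simple_graph G \<longleftrightarrow>
     finite (verts G) \<and> (\<forall>e\<in>edges G. e \<subseteq> verts G \<and> card e = 2)"

definition neighbours :: "'a ugraph \<Rightarrow> 'a \<Rightarrow> 'a set" where
  "neighbours G x = {y. {x, y} \<in> edges G}"

definition vdegree :: "'a ugraph \<Rightarrow> 'a \<Rightarrow> nat" where
  "vdegree G x = card (neighbours G x)"

definition subgraph :: "'a ugraph \<Rightarrow> 'a ugraph \<Rightarrow> bool" where
  "subgraph H G \<longleftrightarrow> simple_graph H \<and> verts H \<subseteq> verts G \<and> edges H \<subseteq> edges G"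

text \<open>The subgraph without vertices is excluded: it has no vertex of any degree.\<close>

definition degenerate :: "nat \<Rightarrow> 'a ugraph \<Rightarrow> bool" where
  "degenerate d G \<longleftrightarrow>
     (\<forall>H. subgraph H G \<and> verts H \<noteq> {} \<longrightarrow> (\<exists>x\<in>verts H. vdegree H x \<le> d))"

text \<open>A vertex ordering \<open>v\<^sub>1, \<dots>, v\<^sub>n\<close> is a bijection \<open>v\<close> from \<open>{1..n}\<close> to the vertex set;
  \<open>back_degree G v i\<close> is the number of backward neighbours of \<open>v i\<close>.\<close>

definition vertex_ordering :: "'a ugraph \<Rightarrow> nat \<Rightarrow> (nat \<Rightarrow> 'a) \<Rightarrow> bool" where
  "vertex_ordering G n v \<longleftrightarrow> bij_betw v {1..n} (verts G)"

definition back_degree :: "'a ugraph \<Rightarrow> (nat \<Rightarrow> 'a) \<Rightarrow> nat \<Rightarrow> nat" where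
  "back_degree G v i = card {x \<in> neighbours G (v i). \<exists>j\<in>{1..<i}. x = v j}"

text \<open>\<open>G'\<close> arises from \<open>G\<close> by adding, for each \<open>i\<close> in \<open>{1..n}\<close>, exactly \<open>k i\<close> new vertices of
  degree 1 adjacent to \<open>v i\<close>. No edge is added inside \<open>verts G\<close>, and no two new vertices are
  adjacent.\<close>

definition add_pendants ::
    "'a ugraph \<Rightarrow> nat \<Rightarrow> (nat \<Rightarrow> 'a) \<Rightarrow> (nat \<Rightarrow> nat) \<Rightarrow> 'a ugraph \<Rightarrow> bool" where
  "add_pendants G n v k G' \<longleftrightarrow>
     simple_graph G' \<and>
     verts G \<subseteq> verts G' \<and>
     edges G = {e \<in> edges G'. e \<subseteq> verts G} \<and>
     (\<forall>w\<in>verts G' - verts G. vdegree G' w = 1 \<and> (\<exists>x\<in>verts G. {x, w} \<in> edges G')) \<and>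
     (\<forall>i\<in>{1..n}. card {w \<in> verts G' - verts G. {v i, w} \<in> edges G'} = k i)"

text \<open>The edge \<open>e\<close> is oriented from \<open>tail e\<close> to \<open>head e\<close>; in a simple graph these differ
  because \<open>e\<close> has two elements.\<close>

definition orientation :: "'a ugraph \<Rightarrow> ('a set \<Rightarrow> 'a) \<Rightarrow> ('a set \<Rightarrow> 'a) \<Rightarrow> bool" where
  "orientation H tail head \<longleftrightarrow> (\<forall>e\<in>edges H. e = {tail e, head e})"

text \<open>Vertices are tagged with \<open>Inl\<close> and edges with \<open>Inr\<close>, so \<open>verts H <+> edges H\<close> is the
  disjoint union of vertex set and edge set. For distinct edges \<open>e, f\<close> of a simple graph, \<open>f\<close>
  contains at most one end of \<open>e\<close>, so the order of the tests is irrelevant.\<close>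

fun A_entry :: "('a set \<Rightarrow> 'a) \<Rightarrow> ('a set \<Rightarrow> 'a) \<Rightarrow> 'a set \<Rightarrow> 'a + 'a set \<Rightarrow> int" where
  "A_entry tail head e (Inl x) =
     (if x = head e then 1 else if x = tail e then - 1 else 0)"
| "A_entry tail head e (Inr f) =
     (if f \<noteq> e \<and> head e \<in> f then 1 else if f \<noteq> e \<and> tail e \<in> f then - 1 else 0)"

text \<open>The permanent of a matrix with finite row index set \<open>R\<close> and finite column index set \<open>C\<close> of
  equal size; the extensional function space makes each bijection count once.\<close>

definition permanent :: "'r set \<Rightarrow> 'c set \<Rightarrow> ('r \<Rightarrow> 'c \<Rightarrow> int) \<Rightarrow> int" where
  "permanent R C M = (\<Sum>f\<in>{f \<in> R \<rightarrow>\<^sub>E C. bij_betw f R C}. \<Prod>r\<in>R. M r (f r))"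

text \<open>The columns of \<open>A\<^sub>H(\<eta>)\<close> are the pairs \<open>(z, c)\<close> with \<open>c < \<eta> z\<close>, where \<open>c\<close> numbers the copies
  of the column of \<open>z\<close>.\<close>

definition index_columns :: "'a ugraph \<Rightarrow> ('a + 'a set \<Rightarrow> nat) \<Rightarrow> (('a + 'a set) \<times> nat) set" where
  "index_columns H \<eta> = (SIGMA z : verts H <+> edges H. {..<\<eta> z})"

definition per_A ::
    "'a ugraph \<Rightarrow> ('a set \<Rightarrow> 'a) \<Rightarrow> ('a set \<Rightarrow> 'a) \<Rightarrow> ('a + 'a set \<Rightarrow> nat) \<Rightarrow> int" where
  "per_A H tail head \<eta> =
     permanent (edges H) (index_columns H \<eta>) (\<lambda>e (z, c). A_entry tail head e z)"

end

theory Submission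
  imports Defs
begin

text \<open>
  The column of an edge \<open>xy\<close> is the sum of the columns of its ends: at the row \<open>xy\<close> both sides
  vanish, since \<open>1 + (-1) = 0\<close>. By multilinearity the permanent is therefore a sum, over all
  choices of an end for every edge of \<open>G\<close>, of permanents all of whose columns are vertex columns.
  A permanent with \<open>m\<close> equal columns is divisible by \<open>m!\<close>, so modulo \<open>d + 1\<close> only those choices
  survive that use no column more than \<open>d\<close> times; as there are \<open>n d\<close> columns, every column is then
  used exactly \<open>d\<close> times. Choosing the later end of every edge has this property. It is the
  only such choice, because the sum of the indices of the chosen ends is determined by the
  multiplicities, and every other choice has a smaller sum. The same argument applied to the rows shows
  that the remaining permanent has only one nonzero class of terms, with sum \<open>\<plusminus> (d!)^n\<close>, and
  this is nonzero modulo the prime \<open>d + 1\<close>.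
\<close>

section \<open>Counting bijections fibre by fibre\<close>

lemma card_bij_betw_PiE:
  assumes "finite A" "finite B"
  shows "card {f \<in> A \<rightarrow>\<^sub>E B. bij_betw f A B} = (if card A = card B then fact (card A) else 0)"
proof (cases "card A = card B")
  case True
  have "f ` A = B" if "f \<in> A \<rightarrow>\<^sub>E B" "inj_on f A" for f
    using that True assms by (intro card_subset_eq) (auto simp: card_image)
  then have "{f \<in> A \<rightarrow>\<^sub>E B. bij_betw f A B} = {f \<in> A \<rightarrow>\<^sub>E B. inj_on f A}"
    by (auto simp: bij_betw_def)
  with True assms show ?thesis
    by (simp add: card_inj_on_subset_funcset fact_prod_rev atLeast0LessThan)
next
  case False
  then have "{f \<in> A \<rightarrow>\<^sub>E B. bij_betw f A B} = {}" by (auto dest: bij_betw_same_card)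
  with False show ?thesis by (simp only: if_False card.empty)
qed

text \<open>A bijection that respects the classes given by \<open>g\<close> and \<open>q\<close>
  restricts to a bijection on each fibre, and bijections of the fibres can be chosen independently
  and glued. The maps \<open>rs\<close> and \<open>gl\<close> are these two mutually inverse
  operations.\<close>

lemma card_fibrewise_bij:
  fixes g :: "'r \<Rightarrow> 'x" and q :: "'c \<Rightarrow> 'x"
  assumes fin: "finite X"
    and g: "g ` R \<subseteq> X" and q: "q ` C \<subseteq> X"
  shows "card {f \<in> R \<rightarrow>\<^sub>E C. bij_betw f R C \<and> (\<forall>r\<in>R. q (f r) = g r)} =
    (\<Prod>x\<in>X. card {h \<in> {r\<in>R. g r = x} \<rightarrow>\<^sub>E {c\<in>C. q c = x}. bij_betw h {r\<in>R. g r = x} {c\<in>C. q c = x}})"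
    (is "card ?L = (\<Prod>x\<in>X. card (?H x))")
proof -
  define rs where "rs f = (\<lambda>x\<in>X. restrict f {r\<in>R. g r = x})" for f :: "'r \<Rightarrow> 'c"
  define gl where "gl h = (\<lambda>r\<in>R. h (g r) r)" for h :: "'x \<Rightarrow> 'r \<Rightarrow> 'c"
  have "bij_betw rs ?L (PiE X ?H)"
  proof (rule bij_betw_byWitness[where f' = gl])
    show "\<forall>f\<in>?L. gl (rs f) = f"
      using g by (force simp: gl_def rs_def PiE_def extensional_def fun_eq_iff)
    show "\<forall>h\<in>PiE X ?H. rs (gl h) = h"
    proof
      fix h assume h: "h \<in> PiE X ?H"
      show "rs (gl h) = h"
      proof
        fix x
        show "rs (gl h) x = h x"
        proof (cases "x \<in> X")
          case True
          then have "h x \<in> extensional {r\<in>R. g r = x}"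
            using h by (auto simp: PiE_def)
          with True show ?thesis
            by (auto simp: rs_def gl_def fun_eq_iff extensional_def)
        next
          case False
          then show ?thesis using h by (auto simp: rs_def PiE_def extensional_def)
        qed
      qed
    qed
    show "rs ` ?L \<subseteq> PiE X ?H"
    proof (rule image_subsetI)
      fix f assume "f \<in> ?L"
      then have f: "f \<in> R \<rightarrow>\<^sub>E C" "bij_betw f R C" "\<forall>r\<in>R. q (f r) = g r" by auto
      have "bij_betw (restrict f {r\<in>R. g r = x}) {r\<in>R. g r = x} {c\<in>C. q c = x}" for x
        using f unfolding bij_betw_def inj_on_def by (auto simp: image_iff)
      then show "rs f \<in> PiE X ?H"
        using f by (auto simp: rs_def split: if_splits)
    qed
    show "gl ` PiE X ?H \<subseteq> ?L"
    proof (rule image_subsetI)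
      fix h assume h: "h \<in> PiE X ?H"
      have bij: "bij_betw (h x) {r\<in>R. g r = x} {c\<in>C. q c = x}" if "x \<in> X" for x
        using h that by (auto simp: PiE_def Pi_def)
      have gr: "g r \<in> X" if "r \<in> R" for r using g that by auto
      have mem: "h (g r) r \<in> C \<and> q (h (g r) r) = g r" if "r \<in> R" for r
        using bij[OF gr[OF that]] that by (auto simp: bij_betw_def)
      have "gl h \<in> R \<rightarrow>\<^sub>E C" using mem by (auto simp: gl_def)
      moreover have "\<forall>r\<in>R. q (gl h r) = g r" using mem by (simp add: gl_def)
      moreover have "inj_on (gl h) R"
      proof (rule inj_onI)
        fix r s assume rs: "r \<in> R" "s \<in> R" "gl h r = gl h s"
        \<comment> \<open>Applying \<open>q\<close> to a value recovers the class of its argument,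
          so two rows with the same value lie in one fibre, where \<open>h (g r)\<close> is
          injective.\<close>
        then have eq: "g r = g s" using mem by (metis gl_def restrict_apply')
        then have "h (g r) r = h (g r) s" using rs by (simp add: gl_def)
        with bij[OF gr[OF rs(1)]] eq rs show "r = s"
          by (auto simp: bij_betw_def inj_on_def)
      qed
      moreover have "C \<subseteq> gl h ` R"
      proof
        fix c assume c: "c \<in> C"
        with q have "q c \<in> X" by auto
        from bij[OF this] c obtain r where "r \<in> R" "g r = q c" "h (q c) r = c"
          by (force simp: bij_betw_def set_eq_iff image_iff)
        then show "c \<in> gl h ` R" by (force simp: gl_def)
      qed
      ultimately show "gl h \<in> ?L"
        by (auto simp: bij_betw_def)
    qed
  qed
  then have "card ?L = card (PiE X ?H)" by (rule bij_betw_same_card)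
  then show ?thesis by (simp add: card_PiE fin)
qed

section \<open>Permanents with split and repeated columns\<close>

text \<open>Multilinearity in the columns: for a fixed bijection the product over rows becomes a
  product over columns, and distributing it amounts to choosing one summand \<open>q c\<close> for
  every column.\<close>

lemma permanent_sum_entries:
  assumes "finite R" "finite C" "\<And>c. c \<in> C \<Longrightarrow> finite (S c)"
  shows "permanent R C (\<lambda>r c. \<Sum>x\<in>S c. a r x) =
    (\<Sum>q\<in>PiE C S. permanent R C (\<lambda>r c. a r (q c)))"
proof -
  have "(\<Prod>r\<in>R. \<Sum>x\<in>S (f r). a r x) = (\<Sum>q\<in>PiE C S. \<Prod>r\<in>R. a r (q (f r)))"
    if f: "bij_betw f R C" for f
  proof -
    let ?i = "inv_into R f"
    have i: "?i (f r) = r" if "r \<in> R" for r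
      using f that by (simp add: bij_betw_def)
    have "(\<Prod>r\<in>R. \<Sum>x\<in>S (f r). a r x) = (\<Prod>r\<in>R. \<Sum>x\<in>S (f r). a (?i (f r)) x)"
      by (intro prod.cong) (simp_all add: i)
    also have "\<dots> = (\<Prod>c\<in>C. \<Sum>x\<in>S c. a (?i c) x)"
      by (rule prod.reindex_bij_betw[OF f])
    also have "\<dots> = (\<Sum>q\<in>PiE C S. \<Prod>c\<in>C. a (?i c) (q c))"
      using assms by (simp add: prod_sum_PiE)
    also have "\<dots> = (\<Sum>q\<in>PiE C S. \<Prod>r\<in>R. a (?i (f r)) (q (f r)))"
      by (simp add: prod.reindex_bij_betw[OF f, where g = "\<lambda>c. a (?i c) (_ c)"])
    also have "\<dots> = (\<Sum>q\<in>PiE C S. \<Prod>r\<in>R. a r (q (f r)))"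
      by (intro sum.cong prod.cong) (simp_all add: i)
    finally show ?thesis .
  qed
  then show ?thesis
    unfolding permanent_def by (subst sum.swap) (intro sum.cong refl, simp)
qed

text \<open>The term of a bijection depends only on the class map \<open>g\<close> it induces on the
  rows. Grouping by \<open>g\<close> gives one factorial for each class, provided that rows and
  columns of that class are equally many.\<close>

lemma permanent_column_classes:
  assumes "finite R" "finite C" "finite X" "q ` C \<subseteq> X"
  shows "permanent R C (\<lambda>r c. a r (q c)) =
    (\<Sum>g\<in>R \<rightarrow>\<^sub>E X.
      (\<Prod>x\<in>X. if card {r\<in>R. g r = x} = card {c\<in>C. q c = x} then fact (card {c\<in>C. q c = x}) else 0) *
      (\<Prod>r\<in>R. a r (g r)))"
proof -
  let ?B = "{f \<in> R \<rightarrow>\<^sub>E C. bij_betw f R C}"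
  let ?q = "\<lambda>f. restrict (\<lambda>r. q (f r)) R"
  have finB: "finite ?B" using assms by (simp add: finite_PiE)
  have "permanent R C (\<lambda>r c. a r (q c)) = (\<Sum>f\<in>?B. \<Prod>r\<in>R. a r (?q f r))"
    unfolding permanent_def by (intro sum.cong prod.cong) auto
  also have "\<dots> = (\<Sum>g\<in>R \<rightarrow>\<^sub>E X. of_nat (card {f \<in> ?B. ?q f = g}) * (\<Prod>r\<in>R. a r (g r)))"
    using assms finB by (intro sum_fun_comp) (auto simp: finite_PiE, blast)
  also have "\<dots> = (\<Sum>g\<in>R \<rightarrow>\<^sub>E X.
      (\<Prod>x\<in>X. if card {r\<in>R. g r = x} = card {c\<in>C. q c = x} then fact (card {c\<in>C. q c = x}) else 0) *
      (\<Prod>r\<in>R. a r (g r)))"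
  proof (intro sum.cong refl arg_cong2[where f = "(*)"])
    fix g assume g: "g \<in> R \<rightarrow>\<^sub>E X"
    have "{f \<in> ?B. ?q f = g} = {f \<in> R \<rightarrow>\<^sub>E C. bij_betw f R C \<and> (\<forall>r\<in>R. q (f r) = g r)}"
      using g by (auto simp: fun_eq_iff PiE_def extensional_def)
    moreover have "g ` R \<subseteq> X" using g by auto
    ultimately have "card {f \<in> ?B. ?q f = g} = (\<Prod>x\<in>X.
        card {h \<in> {r\<in>R. g r = x} \<rightarrow>\<^sub>E {c\<in>C. q c = x}. bij_betw h {r\<in>R. g r = x} {c\<in>C. q c = x}})"
      using assms by (simp add: card_fibrewise_bij)
    also have "\<dots> = (\<Prod>x\<in>X. if card {r\<in>R. g r = x} = card {c\<in>C. q c = x} then fact (card {c\<in>C. q c = x}) else 0)"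
      using assms by (intro prod.cong refl) (simp add: card_bij_betw_PiE)
    finally show "int (card {f \<in> ?B. ?q f = g}) = (\<Prod>x\<in>X. if card {r\<in>R. g r = x} = card {c\<in>C. q c = x} then fact (card {c\<in>C. q c = x}) else 0)"
      by (simp add: if_distrib[of int] cong: if_cong)
  qed
  finally show ?thesis .
qed

section \<open>Extremal choices and nonvanishing modulo a prime\<close>

text \<open>Equal fibre sizes give \<open>q\<close> and \<open>b\<close> the same total weight, so
  none of the pointwise inequalities is strict; injectivity of \<open>w\<close> turns equal weights
  into equal points.\<close>

lemma eq_on_if_le_and_same_fibres:
  fixes w :: "'x \<Rightarrow> nat"
  assumes fin: "finite C" "finite X" and inj: "inj_on w X"
    and q: "q ` C \<subseteq> X" and b: "b ` C \<subseteq> X"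
    and le: "\<And>c. c \<in> C \<Longrightarrow> w (q c) \<le> w (b c)"
    and fib: "\<And>x. x \<in> X \<Longrightarrow> card {c\<in>C. q c = x} = card {c\<in>C. b c = x}"
    and c: "c \<in> C"
  shows "q c = b c"
proof -
  have "(\<Sum>c\<in>C. w (q c)) = (\<Sum>c\<in>C. w (b c))"
    using sum_fun_comp[OF fin q, of w] sum_fun_comp[OF fin b, of w] fib by simp
  then have "w (q c) = w (b c)"
    using sum_mono_inv[of "\<lambda>c. w (q c)" C "\<lambda>c. w (b c)" c] le c fin(1) by simp
  with inj q b c show ?thesis by (auto dest: inj_onD)
qed

text \<open>Here \<open>X\<close> is the set of vertices of \<open>G\<close>, \<open>w\<close> the index of a vertex, \<open>S c\<close> the set of vertices whose
  columns add up to the column \<open>c\<close>, and \<open>b c\<close> and \<open>h r\<close> are the latest vertices of \<open>S c\<close> and of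
  the edge \<open>r\<close>.\<close>

lemma permanent_not_cong_0:
  fixes w :: "'x \<Rightarrow> nat" and a :: "'r \<Rightarrow> 'x \<Rightarrow> int" and b :: "'c \<Rightarrow> 'x"
  assumes p: "prime (Suc d)" and fin: "finite R" "finite C" "finite X"
    and inj: "inj_on w X"
    and S: "\<And>c. c \<in> C \<Longrightarrow> S c \<subseteq> X"
    and b: "\<And>c. c \<in> C \<Longrightarrow> b c \<in> S c"
    and b_max: "\<And>c x. c \<in> C \<Longrightarrow> x \<in> S c \<Longrightarrow> w x \<le> w (b c)"
    and b_fib: "\<And>x. x \<in> X \<Longrightarrow> card {c\<in>C. b c = x} = d"
    and h: "\<And>r. r \<in> R \<Longrightarrow> h r \<in> X"
    and h_max: "\<And>r x. r \<in> R \<Longrightarrow> x \<in> X \<Longrightarrow> a r x \<noteq> 0 \<Longrightarrow> w x \<le> w (h r)"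
    and h_fib: "\<And>x. x \<in> X \<Longrightarrow> card {r\<in>R. h r = x} = d"
    and h_unit: "\<And>r. r \<in> R \<Longrightarrow> \<bar>a r (h r)\<bar> = 1"
  shows "\<not> [permanent R C (\<lambda>r c. \<Sum>x\<in>S c. a r x) = 0] (mod int (Suc d))"
proof -
  let ?p = "int (Suc d)"
  let ?b = "restrict b C" and ?h = "restrict h R"
  \<comment> \<open>\<open>N g q\<close> is the number of bijections inducing the class map
    \<open>g\<close> when the columns are chosen by \<open>q\<close>.\<close>
  define N where "N g q = (\<Prod>x\<in>X. if card {r\<in>R. g r = x} = card {c\<in>C. q c = x}
      then fact (card {c\<in>C. q c = x}) else 0 :: int)" for g :: "'r \<Rightarrow> 'x" and q :: "'c \<Rightarrow> 'x"
  have pp: "prime ?p" using p by (simp only: prime_nat_int_transfer)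
  have finS: "finite (S c)" if "c \<in> C" for c
    using S[OF that] fin(3) by (rule finite_subset)
  have bX: "b ` C \<subseteq> X" using b S by blast
  have hX: "h ` R \<subseteq> X" using h by blast
  have qX: "q ` C \<subseteq> X" if "q \<in> PiE C S" for q using that S by fast
  have per: "permanent R C (\<lambda>r c. a r (q c)) = (\<Sum>g\<in>R \<rightarrow>\<^sub>E X. N g q * (\<Prod>r\<in>R. a r (g r)))"
    if "q \<in> PiE C S" for q
    unfolding N_def by (rule permanent_column_classes[OF fin qX[OF that]])
  have b_mem: "?b \<in> PiE C S" using b by auto
  have other: "?p dvd permanent R C (\<lambda>r c. a r (q c))" if q: "q \<in> PiE C S" and ne: "q \<noteq> ?b" for q
  proof -
    \<comment> \<open>If all multiplicities were at most \<open>d\<close>, comparing the totals,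
      both equal to \<open>card C\<close>, would make each of them exactly \<open>d\<close>. The
      weight comparison with \<open>b\<close> would then give \<open>q = ?b\<close>.\<close>
    have "\<exists>x\<in>X. d < card {c\<in>C. q c = x}"
    proof (rule ccontr)
      assume "\<not> ?thesis"
      then have le: "card {c\<in>C. q c = x} \<le> card {c\<in>C. b c = x}" if "x \<in> X" for x
        using that b_fib by auto
      have "(\<Sum>x\<in>X. card {c\<in>C. q c = x}) = (\<Sum>x\<in>X. card {c\<in>C. b c = x})"
        using sum.group[OF fin(2,3) qX[OF q], of "\<lambda>_. 1::nat"]
          sum.group[OF fin(2,3) bX, of "\<lambda>_. 1::nat"] by simp
      from sum_mono_inv[OF this le _ fin(3)]
      have fib: "card {c\<in>C. q c = x} = card {c\<in>C. b c = x}" if "x \<in> X" for x using that by blast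
      have "q c = b c" if "c \<in> C" for c
        using eq_on_if_le_and_same_fibres[OF fin(2,3) inj qX[OF q] bX _ fib that] b_max q that
        by (meson PiE_mem)
      then have "q = ?b" using q by (auto simp: fun_eq_iff PiE_def extensional_def)
      with ne show False by simp
    qed
    then obtain x where x: "x \<in> X" "Suc d \<le> card {c\<in>C. q c = x}" by (auto simp: Suc_le_eq)
    then have "?p dvd fact (card {c\<in>C. q c = x})"
      using dvd_fact[of "Suc d" "card {c\<in>C. q c = x}"]
      by (metis le_add1 of_nat_dvd_iff of_nat_fact plus_1_eq_Suc)
    \<comment> \<open>The factor at \<open>x\<close> is either zero or this factorial, and
      \<open>?p\<close> divides both.\<close>
    then have "?p dvd N g q" for g
      unfolding N_def using x(1) fin(3) by (intro dvd_trans[OF _ dvd_prodI[OF fin(3) x(1)]]) auto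
    then show ?thesis unfolding per[OF q] by (intro dvd_sum dvd_mult2)
  qed
  have "permanent R C (\<lambda>r c. a r (?b c)) = N ?h ?b * (\<Prod>r\<in>R. a r (?h r))"
  proof -
    \<comment> \<open>In a nonzero term every class is used by exactly \<open>d\<close> rows and
      every entry \<open>a r (g r)\<close> is nonzero, so \<open>h_max\<close> applies and the
      weight comparison, now over rows, gives \<open>g = ?h\<close>.\<close>
    have "N g ?b * (\<Prod>r\<in>R. a r (g r)) = 0" if g: "g \<in> R \<rightarrow>\<^sub>E X" and ne: "g \<noteq> ?h" for g
    proof (rule ccontr)
      assume nz: "\<not> ?thesis"
      have cb: "{c\<in>C. ?b c = x} = {c\<in>C. b c = x}" for x by auto
      have fib: "card {r\<in>R. g r = x} = card {r\<in>R. h r = x}" if "x \<in> X" for x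
        using nz that fin(3) b_fib h_fib unfolding N_def cb by (auto split: if_splits)
      have "w (g r) \<le> w (h r)" if "r \<in> R" for r
        using nz that g fin(1) by (intro h_max) auto
      moreover have "g ` R \<subseteq> X" using g by auto
      ultimately have "g r = h r" if "r \<in> R" for r
        using eq_on_if_le_and_same_fibres[OF fin(1,3) inj _ hX _ fib that] by blast
      then have "g = ?h" using g by (auto simp: fun_eq_iff PiE_def extensional_def)
      with ne show False by simp
    qed
    moreover have "?h \<in> R \<rightarrow>\<^sub>E X" using h by auto
    ultimately show ?thesis
      unfolding per[OF b_mem] using fin
      by (subst sum.mono_neutral_right[of _ "{?h}"]) (auto simp: finite_PiE)
  qed
  moreover have "N ?h ?b = fact d ^ card X"
  proof -
    have "{c\<in>C. ?b c = x} = {c\<in>C. b c = x}" "{r\<in>R. ?h r = x} = {r\<in>R. h r = x}" for x by auto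
    then show ?thesis unfolding N_def by (simp add: b_fib h_fib)
  qed
  moreover have "\<not> ?p dvd fact d ^ card X * (\<Prod>r\<in>R. a r (?h r))"
  proof -
    \<comment> \<open>The prime \<open>d + 1\<close> exceeds every factor of
      \<open>d!\<close>.\<close>
    have "\<not> Suc d dvd fact d" using prime_dvd_fact_iff[OF p, of d] by simp
    then have 1: "\<not> ?p dvd fact d" by (metis of_nat_dvd_iff of_nat_fact)
    have "\<bar>\<Prod>r\<in>R. a r (?h r)\<bar> = 1" by (simp add: abs_prod h_unit)
    then have "\<not> ?p dvd (\<Prod>r\<in>R. a r (?h r))"
      using pp by (metis dvd_abs_iff not_prime_unit)
    with 1 show ?thesis using pp
      by (metis prime_dvd_mult_iff prime_dvd_power)
  qed
  ultimately have main: "\<not> ?p dvd permanent R C (\<lambda>r c. a r (?b c))" by simp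
  have "finite (PiE C S)" using fin finS by (simp add: finite_PiE)
  then have "permanent R C (\<lambda>r c. \<Sum>x\<in>S c. a r x) = permanent R C (\<lambda>r c. a r (?b c)) +
      (\<Sum>q\<in>PiE C S - {?b}. permanent R C (\<lambda>r c. a r (q c)))"
    using b_mem by (simp only: permanent_sum_entries[OF fin(1,2) finS] sum.remove)
  moreover have "?p dvd (\<Sum>q\<in>PiE C S - {?b}. permanent R C (\<lambda>r c. a r (q c)))"
    using other by (intro dvd_sum) auto
  ultimately show ?thesis using main by (simp only: cong_0_iff dvd_add_left_iff) simp
qed

section \<open>Later ends of the edges of the extended graph\<close>

theorem theorem9:
  fixes d n :: nat
    and G G' :: "'a ugraph"
    and v :: "nat \<Rightarrow> 'a"
    and tail head :: "'a set \<Rightarrow> 'a"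
    and \<eta> :: "'a + 'a set \<Rightarrow> nat"
  assumes "d > 0"
    and "prime (d + 1)"
    and "simple_graph G"
    and "degenerate d G"
    and "vertex_ordering G n v"
    and "\<forall>i\<in>{1..n}. back_degree G v i \<le> d"
    and "add_pendants G n v (\<lambda>i. d - back_degree G v i) G'"
    and "orientation G' tail head"
    and "\<forall>i\<in>{1..n}. \<eta> (Inl (v i)) = d - back_degree G v i"
    and "\<forall>e\<in>edges G. \<eta> (Inr e) = 1"
    and "\<forall>w\<in>verts G' - verts G. \<eta> (Inl w) = 0"
    and "\<forall>e\<in>edges G' - edges G. \<eta> (Inr e) = 0"
  shows "\<not> [per_A G' tail head \<eta> = 0] (mod int (d + 1))"
proof -
  let ?X = "verts G" and ?E = "edges G" and ?E' = "edges G'" and ?C = "index_columns G' \<eta>"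
  define w where "w = inv_into {1..n} v"
  \<comment> \<open>Intersecting with \<open>?X\<close> discards the added end of a pendant edge,
    since only vertices of \<open>G\<close> have an index; one definition thus serves for rows and
    columns.\<close>
  define latest where "latest A = v (Max (w ` (A \<inter> ?X)))" for A
  define S :: "('a + 'a set) \<times> nat \<Rightarrow> 'a set"
    where "S c = (case fst c of Inl x \<Rightarrow> {x} | Inr e \<Rightarrow> e)" for c
  define a where "a r x = A_entry tail head r (Inl x)" for r x
  have bij: "bij_betw v {1..n} ?X" using assms(5) by (simp add: vertex_ordering_def)
  have vX: "v i \<in> ?X" if "i \<in> {1..n}" for i using bij that by (auto simp: bij_betw_def)
  have wv: "w (v i) = i" if "i \<in> {1..n}" for i
    using bij that by (simp add: w_def bij_betw_def)
  have vw: "v (w x) = x" "w x \<in> {1..n}" if "x \<in> ?X" for x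
    using bij that unfolding w_def bij_betw_def
    by (metis f_inv_into_f, metis inv_into_into)
  have inj: "inj_on w ?X" by (metis inj_onI vw(1))
  have G: "e \<subseteq> ?X" "card e = 2" if "e \<in> ?E" for e
    using assms(3) that by (auto simp: simple_graph_def)
  have finX: "finite ?X" using assms(3) by (simp add: simple_graph_def)
  have G': "finite (verts G')" "\<And>e. e \<in> ?E' \<Longrightarrow> e \<subseteq> verts G' \<and> card e = 2"
    and sub: "?X \<subseteq> verts G'" and E_eq: "?E = {e \<in> ?E'. e \<subseteq> ?X}"
    and new: "\<And>y. y \<in> verts G' - ?X \<Longrightarrow> vdegree G' y = 1 \<and> (\<exists>x\<in>?X. {x, y} \<in> ?E')"
    and pend: "\<And>i. i \<in> {1..n} \<Longrightarrow>
      card {y \<in> verts G' - ?X. {v i, y} \<in> ?E'} = d - back_degree G v i"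
    using assms(7) by (auto simp: add_pendants_def simple_graph_def)
  have finE': "finite ?E'"
    using G' by (intro finite_subset[of ?E' "Pow (verts G')"]) auto
  have finE: "finite ?E" using finE' E_eq by simp
  have latest_eq: "latest A = x" if "x \<in> A" "x \<in> ?X" "\<And>y. y \<in> A \<Longrightarrow> y \<in> ?X \<Longrightarrow> w y \<le> w x" for A x
  proof -
    have "Max (w ` (A \<inter> ?X)) = w x" using that finX by (intro Max_eqI) auto
    then show ?thesis using that by (simp add: latest_def vw)
  qed
  have latest: "latest A \<in> A \<inter> ?X \<and> (\<forall>y\<in>A \<inter> ?X. w y \<le> w (latest A))" if "A \<inter> ?X \<noteq> {}" for A
  proof -
    have "Max (w ` (A \<inter> ?X)) \<in> w ` (A \<inter> ?X)" using that finX by (intro Max_in) auto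
    then obtain x where x: "x \<in> A \<inter> ?X" "w x = Max (w ` (A \<inter> ?X))" by auto
    then have "latest A = x" using vw by (simp add: latest_def flip: x(2))
    then show ?thesis using x finX by auto
  qed
  \<comment> \<open>No edge joins two added vertices: the only neighbour of an added vertex lies in \<open>G\<close>.\<close>
  have pair: "\<exists>x y. x \<in> ?X \<and> x \<noteq> y \<and> e = {x, y}" if e: "e \<in> ?E'" for e
  proof -
    obtain x y where xy: "e = {x, y}" "x \<noteq> y" using G'(2)[OF e] by (auto simp: card_2_iff)
    have "x \<in> ?X" if "y \<notin> ?X"
    proof -
      from that xy G'(2)[OF e] new[of y] obtain z
        where z: "z \<in> ?X" "{z, y} \<in> ?E'" "card (neighbours G' y) = 1"
        by (auto simp: vdegree_def)
      then have "z \<in> neighbours G' y" "x \<in> neighbours G' y"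
        using e xy by (auto simp: neighbours_def insert_commute)
      with z(3) have "x = z" by (metis card_1_singletonE singletonD)
      with z show ?thesis by simp
    qed
    with xy show ?thesis by (metis insert_commute)
  qed
  \<comment> \<open>An edge whose later end is \<open>v i\<close> has its other end at a smaller
    index, and each backward neighbour determines one such edge.\<close>
  have backward: "card {e \<in> ?E. latest e = v i} = back_degree G v i" if i: "i \<in> {1..n}" for i
  proof -
    let ?B = "{x \<in> neighbours G (v i). \<exists>j\<in>{1..<i}. x = v j}"
    have "{e \<in> ?E. latest e = v i} = (\<lambda>x. {v i, x}) ` ?B"
    proof (intro equalityI subsetI)
      fix e assume "e \<in> {e \<in> ?E. latest e = v i}"
      then have e: "e \<in> ?E" "latest e = v i" by auto
      then obtain x y where xy: "e = {x, y}" "x \<noteq> y" using G(2)[OF e(1)] by (auto simp: card_2_iff)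
      have "latest e \<in> e" and le: "\<And>y. y \<in> e \<Longrightarrow> w y \<le> i"
        using latest[of e] G(1)[OF e(1)] xy e(2) wv[OF i] by auto
      with e(2) xy obtain z where z: "e = {v i, z}" "v i \<noteq> z" by auto
      then have zX: "z \<in> ?X" using G(1)[OF e(1)] by auto
      have "w z \<in> {1..<i}" using le[of z] z vw[OF zX] by (cases "w z = i") auto
      moreover have "z = v (w z)" using vw[OF zX] by simp
      ultimately have "z \<in> ?B" using e(1) z(1) unfolding neighbours_def by blast
      with z(1) show "e \<in> (\<lambda>x. {v i, x}) ` ?B" by blast
    next
      fix e assume "e \<in> (\<lambda>x. {v i, x}) ` ?B"
      then obtain j where j: "j \<in> {1..<i}" "e = {v i, v j}" "e \<in> ?E"
        by (auto simp: neighbours_def)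
      then have "latest e = v i"
        using i wv vX by (intro latest_eq) auto
      with j show "e \<in> {e \<in> ?E. latest e = v i}" by simp
    qed
    moreover have "inj_on (\<lambda>x. {v i, x}) ?B" by (auto simp: inj_on_def doubleton_eq_iff)
    ultimately show ?thesis by (simp add: card_image back_degree_def)
  qed
  \<comment> \<open>An edge outside \<open>G\<close> has exactly one end in \<open>G\<close>, which
    is therefore its \<open>latest\<close>; its other end is an added vertex and determines
    it.\<close>
  have pendant: "card {e \<in> ?E' - ?E. latest e = v i} = d - back_degree G v i"
    if i: "i \<in> {1..n}" for i
  proof -
    let ?P = "{y \<in> verts G' - ?X. {v i, y} \<in> ?E'}"
    have "{e \<in> ?E' - ?E. latest e = v i} = (\<lambda>y. {v i, y}) ` ?P"
    proof (intro equalityI subsetI)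
      fix e assume "e \<in> {e \<in> ?E' - ?E. latest e = v i}"
      then have e: "e \<in> ?E'" "e \<notin> ?E" "latest e = v i" by auto
      then obtain x y where xy: "x \<in> ?X" "e = {x, y}" using pair by blast
      with e E_eq have y: "y \<notin> ?X" by auto
      have "latest e = x" using xy y by (intro latest_eq) auto
      with e xy y G'(2)[OF e(1)] show "e \<in> (\<lambda>y. {v i, y}) ` ?P" by auto
    next
      fix e assume "e \<in> (\<lambda>y. {v i, y}) ` ?P"
      then obtain y where y: "y \<in> verts G' - ?X" "e = {v i, y}" "e \<in> ?E'" by auto
      then have "latest e = v i" using vX[OF i] by (intro latest_eq) auto
      with y E_eq show "e \<in> {e \<in> ?E' - ?E. latest e = v i}" by auto
    qed
    moreover have "inj_on (\<lambda>y. {v i, y}) ?P" by (auto simp: inj_on_def doubleton_eq_iff)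
    ultimately show ?thesis using pend[OF i] by (simp add: card_image)
  qed
  have eta_eq: "\<eta> (Inl (v i)) = d - back_degree G v i" if "i \<in> {1..n}" for i
    using assms(9) that by blast
  have C_eq: "?C = (SIGMA z : Inl ` ?X. {..<\<eta> z}) \<union> (\<lambda>e. (Inr e, 0)) ` ?E" (is "_ = ?C'")
  proof (intro equalityI subsetI)
    fix c assume "c \<in> ?C"
    then obtain z k where c: "c = (z, k)" "z \<in> verts G' <+> ?E'" "k < \<eta> z"
      by (auto simp: index_columns_def)
    from c(2) consider (1) x where "z = Inl x" "x \<in> verts G'" | (2) e where "z = Inr e" "e \<in> ?E'"
      by auto
    then show "c \<in> ?C'"
    proof cases
      case (1 x)
      with c assms(11) show ?thesis by (cases "x \<in> ?X") auto
    next
      case (2 e)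
      with c assms(10,12) show ?thesis by (cases "e \<in> ?E") auto
    qed
  next
    fix c assume "c \<in> ?C'"
    then show "c \<in> ?C" using sub E_eq assms(10) by (auto simp: index_columns_def)
  qed
  have finC: "finite ?C" unfolding C_eq using finX finE by auto
  have S_Inl [simp]: "S (Inl x, k) = {x}" and S_Inr [simp]: "S (Inr e, k) = e" for x e k
    by (simp_all add: S_def)
  have SX: "S c \<subseteq> ?X" "S c \<noteq> {}" if "c \<in> ?C" for c
    using that G(1,2) unfolding C_eq by fastforce+
  have SX_latest: "latest (S c) \<in> S c" "\<And>x. x \<in> S c \<Longrightarrow> w x \<le> w (latest (S c))" if "c \<in> ?C" for c
    using latest[of "S c"] SX[OF that] by blast+
  have C_fib: "card {c \<in> ?C. latest (S c) = x} = d" if x: "x \<in> ?X" for x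
  proof -
    from x obtain i where i: "i \<in> {1..n}" "x = v i" using vw by metis
    have l1: "latest {y} = y" if "y \<in> ?X" for y using that by (intro latest_eq) auto
    have "{c \<in> ?C. latest (S c) = x} =
        Pair (Inl x) ` {..<\<eta> (Inl x)} \<union> (\<lambda>e. (Inr e, 0)) ` {e \<in> ?E. latest e = v i}"
      unfolding C_eq using x i by (auto simp: l1)
    also have "card \<dots> = card (Pair (Inl x :: 'a + 'a set) ` {..<\<eta> (Inl x)}) +
        card ((\<lambda>e. (Inr e :: 'a + 'a set, 0::nat)) ` {e \<in> ?E. latest e = v i})"
      using finE by (intro card_Un_disjoint) auto
    also have "\<dots> = \<eta> (Inl x) + card {e \<in> ?E. latest e = v i}"
      by (simp add: card_image inj_on_def)
    \<comment> \<open>The subtraction on naturals does not truncate, because the backward degree is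
      at most \<open>d\<close>.\<close>
    also have "\<dots> = d" using backward[OF i(1)] eta_eq[OF i(1)] i assms(6) by simp
    finally show ?thesis .
  qed
  \<comment> \<open>Pendant edges complete the rows just as the copies of vertex columns complete
    the columns: both supply the \<open>d - back_degree G v i\<close> missing after the edges of
    \<open>G\<close>.\<close>
  have R_fib: "card {r \<in> ?E'. latest r = x} = d" if x: "x \<in> ?X" for x
  proof -
    from x obtain i where i: "i \<in> {1..n}" "x = v i" using vw by metis
    have "{r \<in> ?E'. latest r = x} = {e \<in> ?E' - ?E. latest e = v i} \<union> {e \<in> ?E. latest e = v i}"
      using i E_eq by auto
    also have "card \<dots> = card {e \<in> ?E' - ?E. latest e = v i} + card {e \<in> ?E. latest e = v i}"
      using finE finE' by (intro card_Un_disjoint) auto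
    also have "\<dots> = d" using backward[OF i(1)] pendant[OF i(1)] i assms(6) by simp
    finally show ?thesis .
  qed
  have ends: "r = {tail r, head r}" "tail r \<noteq> head r" if "r \<in> ?E'" for r
  proof -
    show r: "r = {tail r, head r}" using assms(8) that by (auto simp: orientation_def)
    show "tail r \<noteq> head r" using G'(2)[OF that] r by (auto simp: card_2_iff)
  qed
  have a_supp: "x \<in> r" if "r \<in> ?E'" "a r x \<noteq> 0" for r x
    using that ends(1)[of r] by (auto simp: a_def split: if_splits)
  have a_unit: "\<bar>a r x\<bar> = 1" if "r \<in> ?E'" "x \<in> r" for r x
    using that ends(1)[of r] by (auto simp: a_def)
  have entry: "A_entry tail head r (fst c) = (\<Sum>x\<in>S c. a r x)" if r: "r \<in> ?E'" and c: "c \<in> ?C" for r c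
  proof (cases "fst c")
    case (Inl x)
    then show ?thesis by (simp add: S_def a_def)
  next
    case (Inr e)
    with c have e: "e \<in> ?E'" unfolding C_eq using E_eq by auto
    obtain x y where xy: "e = {x, y}" "x \<noteq> y" using pair[OF e] by blast
    show ?thesis
    proof (cases "e = r")
      case True
      \<comment> \<open>The two ends of the row's own edge contribute \<open>-1\<close> and
        \<open>1\<close>, matching the zero that the test \<open>f \<noteq> e\<close> in
        \<open>A_entry\<close> puts there.\<close>
      have "(\<Sum>x\<in>e. a r x) = (\<Sum>x\<in>{tail r, head r}. a r x)" using ends(1)[OF r] True by simp
      also have "\<dots> = 0" using ends(2)[OF r] by (simp add: a_def)
      finally show ?thesis using Inr True by (simp add: S_def)
    next
      case False
      \<comment> \<open>Distinct edges share at most one end, so at most one summand is nonzero and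
        it carries the sign of the shared end.\<close>
      with xy ends[OF r] have "\<not> (tail r \<in> e \<and> head r \<in> e)" by (metis doubleton_eq_iff insertE singletonD)
      with xy ends(2)[OF r] Inr False show ?thesis by (auto simp: S_def a_def)
    qed
  qed
  have "per_A G' tail head \<eta> = permanent ?E' ?C (\<lambda>r c. \<Sum>x\<in>S c. a r x)"
    unfolding per_A_def permanent_def
    by (intro sum.cong prod.cong refl) (auto simp: case_prod_beta entry dest: PiE_mem)
  moreover have "\<not> [permanent ?E' ?C (\<lambda>r c. \<Sum>x\<in>S c. a r x) = 0] (mod int (Suc d))"
  proof (rule permanent_not_cong_0[where X = ?X and w = w and b = "\<lambda>c. latest (S c)" and h = latest])
    have R: "r \<inter> ?X \<noteq> {}" if "r \<in> ?E'" for r using pair[OF that] by blast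
    show "latest r \<in> ?X" if "r \<in> ?E'" for r using latest[OF R[OF that]] by blast
    show "w x \<le> w (latest r)" if "r \<in> ?E'" "x \<in> ?X" "a r x \<noteq> 0" for r x
      using latest[OF R[OF that(1)]] a_supp that by blast
    show "\<bar>a r (latest r)\<bar> = 1" if "r \<in> ?E'" for r
      using latest[OF R[OF that]] a_unit that by blast
  qed (use assms(2) in \<open>simp_all add: finE' finC finX inj SX SX_latest C_fib R_fib\<close>)
  ultimately show ?thesis by simp
qed

end
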